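(* There exists a constant $c\ge1$, depending only on $\mathit{data}$ (in particular not on $\theta$, $\Lambda$, $i$), such that the following holds in the setting described in the context: if $i\in\Theta_2$ and $50U_i\cap\mathcal Q_2\ne\emptyset$, then $$\rho_2-\rho_1\le c\,\theta^{\frac{2-q}p}\,r_i .$$
   Context: Setting. $n\ge2$, $N\ge1$, $\alpha\in(0,1]$, $2<p<q<p+\frac{2\alpha}{n+2}$; $\Omega\subset\mathbb R^n$ bounded domain, $T>0$, $\Omega_T=\Omega\times(0,T)$. $a:\Omega_T\to[0,\infty)$ bounded with $|a(x,t)-a(y,s)|\le[a]_\alpha\max\{|x-y|^\alpha,|t-s|^{\alpha/2}\}$. $\mathcal A:\Omega_T\times\mathbb R^{Nn}\to\mathbb R^{Nn}$ is Carathéodory with $\mathcal A(z,\xi)\cdot\xi\ge L_1(|\xi|^p+a(z)|\xi|^q)$, $|\mathcal A(z,\xi)|\le L_2(|\xi|^{p-1}+a(z)|\xi|^{q-1})$, $0<L_1\le L_2<\infty$. $H(z,s)=s^p+a(z)s^q$; $F:\Omega_T\to\mathbb R^{Nn}$ measurable, $H(z,|F|)\in L^1(\Omega_T)$. $u$ is a very weak solution with deficit $\delta\in(0,1)$, where $\delta>\frac{q-1}p$ and $2-q(1-\delta)>0$: $u\in L^1(0,T;W^{1,1}(\Omega,\mathbb R^N))$, $\iint_{\Omega_T}H(z,|\nabla u|)^\delta dz<\infty$ and $\iint_{\Omega_T}(-u\cdot\varphi_t+\mathcal A(z,\nabla u)\cdot\nabla\varphi)\,dz=\iint_{\Omega_T}(|F|^{p-2}F+a|F|^{q-2}F)\cdot\nabla\varphi\,dz$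 for all $\varphi\in C_0^\infty(\Omega_T,\mathbb R^N)$. $\mathit{data}=(n,N,p,q,\alpha,L_1,L_2,[a]_\alpha)$. $(f)_E=f_E=\frac1{|E|}\iint_Ef\,dz$. Cylinders, with $z_0=(x_0,t_0)$: $Q_r(z_0)=B_r(x_0)\times(t_0-r^2,t_0+r^2)$; $Q_r^\lambda(z_0)=B_r(x_0)\times(t_0-\lambda^{2-p}r^2,t_0+\lambda^{2-p}r^2)$; $G_r^\lambda(z_0)=B_r(x_0)\times\big(t_0-\frac{\lambda^2}{H(z_0,\lambda)}r^2,t_0+\frac{\lambda^2}{H(z_0,\lambda)}r^2\big)$; $kQ_r^\lambda=Q_{kr}^\lambda$, $kG_r^\lambda=G_{kr}^\lambda$ for $k>0$. Underlying intrinsic cylinder. Fix $z_0\in\Omega_T$, $\rho>0$, $\pi>1$, $\Pi=\pi^p+a(z_0)\pi^q$, such that one of the following holds. ($p$-intrinsic) $Q_{16\rho}^\pi(z_0)\subset\Omega_T$, $\pi^p\ge a(z_0)\pi^q$, $\rho^\alpha\le\pi^{p-q}$ and $((H(z,|\nabla u|)+H(z,|F|))^\delta)_{Q_{16\rho}^\pi(z_0)}\le\pi^{\delta p}\le((H(z,|\nabla u|)+H(z,|F|))^\delta)_{Q_\rho^\pi(z_0)}$. ($(p,q)$-intrinsic) $G_{16\rho}^\pi(z_0)\subset\Omega_T$, $\pi^p<a(z_0)\pi^q$, $\frac{a(z_0)}2\le a(z)\le2a(z_0)$ for all $z\in Q_{10\rho}(z_0)\cap\Omega_T$, and $((H(z,|\nabla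 u|)+H(z,|F|))^\delta)_{G_{16\rho}^\pi(z_0)}\le\Pi^\delta\le((H(z,|\nabla u|)+H(z,|F|))^\delta)_{G_\rho^\pi(z_0)}$. Let $\rho\le\rho_1<\rho_2\le4\rho$, and for $i=1,2$ let $\mathcal Q_i=Q_{\rho_i}^\pi(z_0)$ in the $p$-intrinsic and $\mathcal Q_i=G_{\rho_i}^\pi(z_0)$ in the $(p,q)$-intrinsic case, with time interval $(t_0-\sigma_i,t_0+\sigma_i)$. Extension of $a$. From now on $a$ denotes the function on $\mathbb R^{n+1}$ given by $\max\{\min\{\tilde a,\sup_{\mathcal Q_2}a\},\inf_{\mathcal Q_2}a\}$, $\tilde a(x,t)=\inf_{(y,s)\in\mathcal Q_2}\{a(y,s)+[a]_\alpha(|x-y|^\alpha+|t-s|^{\alpha/2})\}$; it agrees with the original $a$ on $\mathcal Q_2$, and $H$ and $G_r^\lambda$ below are formed with it. Bad set and Whitney cylinders. Let $\theta\in(0,1)$, $\Lambda\ge\theta\Pi$. Put $g=(|\nabla u|+\frac{|u-u_{\mathcal Q_2}|}\rho+|F|)\chi_{\mathcal Q_2}$, $\Upsilon=(M(g^{q-1}+(ag^q)^{\frac{q-1}p}))^{\frac p{q-1}}$, where $Mf(z)=\sup_{Q\ni z}\frac1{|Q|}\iint_Q|f|$ over all cylinders $Q=B_r(y)\times(\tau-s,\tau+s)$, $r,s>0$, containing $z$; $E(\Lambda)=\{z\in\mathbb R^{n+1}:\Upsilon(z)\le\Lambda\}$ and $E(\Lambda)^c$ is its complement (an open set of finite measure),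 assumed nonempty. For $z\in E(\Lambda)^c$, $\lambda_z$ is the unique positive number with $\lambda_z^p+a(z)\lambda_z^q=\Lambda$; it is assumed that $\Pi$ is so large (depending on $\theta$) that all $\lambda_z>1$. Let $d_z(z_1,z_2)=\max\{|x_1-x_2|,\sqrt{\lambda_z^{p-2}|t_1-t_2|}\}$ if $\lambda_z^p\ge a(z)\lambda_z^q$ and $d_z(z_1,z_2)=\max\{|x_1-x_2|,\sqrt{\Lambda\lambda_z^{-2}|t_1-t_2|}\}$ otherwise; $4r_z=\inf_{w\in E(\Lambda)}d_z(z,w)$; and $U_z=Q_{r_z}^{\lambda_z}(z)$ if $\lambda_z^p\ge a(z)\lambda_z^q$, $U_z=G_{r_z}^{\lambda_z}(z)$ otherwise. $\{U_i\}_{i\in\mathbb N}$ is a Whitney covering of $E(\Lambda)^c$ by such cylinders: $U_i=U_{z_i}$ with $z_i\in E(\Lambda)^c$, $r_i=r_{z_i}$, $\lambda_i=\lambda_{z_i}$, such that $\bigcup_iU_i=E(\Lambda)^c$, the $\frac18U_i$ are pairwise disjoint, $4U_i\subset E(\Lambda)^c$, $5U_i\cap E(\Lambda)\ne\emptyset$; if $U_i$ is of $Q$-type then $r_i^\alpha\lambda_i^q\le\frac1{800(1+[a]_\alpha)}\lambda_i^p$; and if $U_i$ is of $G$-type then $\frac{a(z_i)}2\le a(z)\le2a(z_i)$ for all $z\in Q_{200r_i}(z_i)$. Index sets. $\mathcal C_1=\mathbb R^n\times(t_0-\frac{4\sigma_1+\sigma_2}5,t_0+\frac{4\sigma_1+\sigma_2}5)$,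 $\mathcal C_2=\mathbb R^n\times(t_0-\frac{3\sigma_1+2\sigma_2}5,t_0+\frac{3\sigma_1+2\sigma_2}5)$, $\Theta=\{i:50U_i\cap\mathcal C_1\ne\emptyset\}$, $\Theta_1=\{i\in\Theta:50U_i\subset\mathcal C_2\}$, $\Theta_2=\Theta\setminus\Theta_1$. *)

theory Defs
  imports "HOL-Analysis.Analysis"
begin

text \<open>
  Space-time points are pairs (x, t) of type \<open>(real^'n) \<times> real\<close>. Gradients of maps into
  \<open>real^'m\<close> are matrices of type \<open>real^'n^'m\<close> (row index: component of the map), whose library
  norm and inner product are the Euclidean ones on \<open>\<real>\<^sup>N\<^sup>n\<close>. The library product norm
  on space-time is never used.
\<close>

type_synonym 'n spacetime = "(real^'n) \<times> real"

definition mean :: "'a::euclidean_space set \<Rightarrow> ('a \<Rightarrow> 'b::{banach, second_countable_topology}) \<Rightarrow> 'b"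
  where "mean E f = (LINT z:E|lebesgue. f z) /\<^sub>R measure lebesgue E"


subsection \<open>Test functions and Sobolev spaces\<close>

primrec C_times :: "nat \<Rightarrow> ('a::euclidean_space \<Rightarrow> 'b::real_normed_vector) \<Rightarrow> bool" where
  "C_times 0 f \<longleftrightarrow> continuous_on UNIV f"
| "C_times (Suc k) f \<longleftrightarrow>
     (\<forall>x. f differentiable (at x)) \<and> (\<forall>v. C_times k (\<lambda>x. frechet_derivative f (at x) v))"

definition test_function :: "'a::euclidean_space set \<Rightarrow> ('a \<Rightarrow> 'b::real_normed_vector) \<Rightarrow> bool" where
  "test_function S \<phi> \<longleftrightarrow>
     (\<forall>k. C_times k \<phi>) \<and> compact (closure {x. \<phi> x \<noteq> 0}) \<and> closure {x. \<phi> x \<noteq> 0} \<subseteq> S"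

definition weak_gradient ::
    "(real^'n) set \<Rightarrow> (real^'n \<Rightarrow> real^'m) \<Rightarrow> (real^'n \<Rightarrow> real^'n^'m) \<Rightarrow> bool" where
  "weak_gradient \<Omega> v Dv \<longleftrightarrow>
     (\<forall>\<phi> :: real^'n \<Rightarrow> real. test_function \<Omega> \<phi> \<longrightarrow>
       (\<forall>j i. (LINT x:\<Omega>|lebesgue. v x $ j * frechet_derivative \<phi> (at x) (axis i 1))
              = - (LINT x:\<Omega>|lebesgue. Dv x $ j $ i * \<phi> x)))"

definition W11 ::
    "(real^'n) set \<Rightarrow> (real^'n \<Rightarrow> real^'m) \<Rightarrow> (real^'n \<Rightarrow> real^'n^'m) \<Rightarrow> bool" where
  "W11 \<Omega> v Dv \<longleftrightarrow>
     set_integrable lebesgue \<Omega> v \<and> set_integrable lebesgue \<Omega> Dv \<and> weak_gradient \<Omega> v Dv"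

definition W11_norm ::
    "(real^'n) set \<Rightarrow> (real^'n \<Rightarrow> real^'m) \<Rightarrow> (real^'n \<Rightarrow> real^'n^'m) \<Rightarrow> real" where
  "W11_norm \<Omega> v Dv = (LINT x:\<Omega>|lebesgue. norm (v x)) + (LINT x:\<Omega>|lebesgue. norm (Dv x))"

text \<open>
  Membership of \<open>u\<close> in \<open>L\<^sup>1(0,T; W\<^sup>1\<^sup>,\<^sup>1(\<Omega>, \<real>\<^sup>N))\<close> with spatial weak gradient
  \<open>Du\<close>. Strongly measurable \<open>W\<^sup>1\<^sup>,\<^sup>1\<close>-valued maps of time are represented by jointly
  measurable functions on \<open>\<Omega> \<times> (0,T)\<close>.
\<close>

definition L1_W11 ::
    "(real^'n) set \<Rightarrow> real \<Rightarrow> ('n spacetime \<Rightarrow> real^'m) \<Rightarrow> ('n spacetime \<Rightarrow> real^'n^'m) \<Rightarrow> bool" where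
  "L1_W11 \<Omega> T u Du \<longleftrightarrow>
     u \<in> borel_measurable (lebesgue_on (\<Omega> \<times> {0<..<T})) \<and>
     Du \<in> borel_measurable (lebesgue_on (\<Omega> \<times> {0<..<T})) \<and>
     (AE t in lebesgue_on {0<..<T}. W11 \<Omega> (\<lambda>x. u (x, t)) (\<lambda>x. Du (x, t))) \<and>
     set_integrable lebesgue {0<..<T} (\<lambda>t. W11_norm \<Omega> (\<lambda>x. u (x, t)) (\<lambda>x. Du (x, t)))"

definition time_deriv :: "('n::finite spacetime \<Rightarrow> real^'m) \<Rightarrow> 'n spacetime \<Rightarrow> real^'m" where
  "time_deriv \<phi> z = frechet_derivative \<phi> (at z) (0, 1)"

definition space_grad :: "('n::finite spacetime \<Rightarrow> real^'m) \<Rightarrow> 'n spacetime \<Rightarrow> real^'n^'m" where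
  "space_grad \<phi> z = (\<chi> j i. frechet_derivative \<phi> (at z) (axis i 1, 0) $ j)"


subsection \<open>The double phase system\<close>

definition H :: "('n spacetime \<Rightarrow> real) \<Rightarrow> real \<Rightarrow> real \<Rightarrow> 'n spacetime \<Rightarrow> real \<Rightarrow> real" where
  "H a p q z s = s powr p + a z * s powr q"

definition admissible_coefficient ::
    "real \<Rightarrow> real \<Rightarrow> 'n::finite spacetime set \<Rightarrow> ('n spacetime \<Rightarrow> real) \<Rightarrow> bool" where
  "admissible_coefficient \<alpha> a\<^sub>\<alpha> S a \<longleftrightarrow>
     (\<forall>z\<in>S. 0 \<le> a z) \<and> bounded (a ` S) \<and>
     (\<forall>(x, t)\<in>S. \<forall>(y, s)\<in>S.
        \<bar>a (x, t) - a (y, s)\<bar> \<le> a\<^sub>\<alpha> * max (norm (x - y) powr \<alpha>) (\<bar>t - s\<bar> powr (\<alpha> / 2)))"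

definition caratheodory ::
    "'a::euclidean_space set \<Rightarrow> ('a \<Rightarrow> 'b::euclidean_space \<Rightarrow> 'b) \<Rightarrow> bool" where
  "caratheodory S A \<longleftrightarrow>
     (\<forall>\<xi>. (\<lambda>z. A z \<xi>) \<in> borel_measurable (lebesgue_on S)) \<and>
     (AE z in lebesgue_on S. continuous_on UNIV (A z))"

definition double_phase_growth ::
    "real \<Rightarrow> real \<Rightarrow> real \<Rightarrow> real \<Rightarrow> 'n::finite spacetime set \<Rightarrow> ('n spacetime \<Rightarrow> real) \<Rightarrow>
     ('n spacetime \<Rightarrow> real^'n^'m \<Rightarrow> real^'n^'m) \<Rightarrow> bool" where
  "double_phase_growth p q L1 L2 S a A \<longleftrightarrow>
     (AE z in lebesgue_on S. \<forall>\<xi>.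
        A z \<xi> \<bullet> \<xi> \<ge> L1 * (norm \<xi> powr p + a z * norm \<xi> powr q) \<and>
        norm (A z \<xi>) \<le> L2 * (norm \<xi> powr (p - 1) + a z * norm \<xi> powr (q - 1)))"

definition very_weak_solution ::
    "real \<Rightarrow> real \<Rightarrow> real \<Rightarrow> (real^'n) set \<Rightarrow> real \<Rightarrow> ('n spacetime \<Rightarrow> real) \<Rightarrow>
     ('n spacetime \<Rightarrow> real^'n^'m \<Rightarrow> real^'n^'m) \<Rightarrow> ('n spacetime \<Rightarrow> real^'n^'m) \<Rightarrow>
     ('n spacetime \<Rightarrow> real^'m) \<Rightarrow> ('n spacetime \<Rightarrow> real^'n^'m) \<Rightarrow> bool" where
  "very_weak_solution p q \<delta> \<Omega> T a A F u Du \<longleftrightarrow>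
     L1_W11 \<Omega> T u Du \<and>
     set_integrable lebesgue (\<Omega> \<times> {0<..<T}) (\<lambda>z. H a p q z (norm (Du z)) powr \<delta>) \<and>
     (\<forall>\<phi> :: 'n spacetime \<Rightarrow> real^'m. test_function (\<Omega> \<times> {0<..<T}) \<phi> \<longrightarrow>
        (LINT z:\<Omega> \<times> {0<..<T}|lebesgue.
           - (u z \<bullet> time_deriv \<phi> z) + A z (Du z) \<bullet> space_grad \<phi> z)
        = (LINT z:\<Omega> \<times> {0<..<T}|lebesgue.
           (norm (F z) powr (p - 2) *\<^sub>R F z + (a z * norm (F z) powr (q - 2)) *\<^sub>R F z)
             \<bullet> space_grad \<phi> z))"


subsection \<open>Cylinders\<close>

definition cyl :: "'n::finite spacetime \<Rightarrow> real \<Rightarrow> real \<Rightarrow> 'n spacetime set" where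
  "cyl z r s = ball (fst z) r \<times> {snd z - s<..<snd z + s}"

definition par_cyl :: "real \<Rightarrow> 'n::finite spacetime \<Rightarrow> 'n spacetime set" where
  "par_cyl r z = cyl z r (r\<^sup>2)"

definition Q_cyl :: "real \<Rightarrow> real \<Rightarrow> real \<Rightarrow> 'n::finite spacetime \<Rightarrow> 'n spacetime set" where
  "Q_cyl p \<mu> r z = cyl z r (\<mu> powr (2 - p) * r\<^sup>2)"

definition G_cyl ::
    "('n spacetime \<Rightarrow> real) \<Rightarrow> real \<Rightarrow> real \<Rightarrow> real \<Rightarrow> real \<Rightarrow> 'n::finite spacetime \<Rightarrow> 'n spacetime set" where
  "G_cyl a p q \<mu> r z = cyl z r (\<mu>\<^sup>2 / H a p q z \<mu> * r\<^sup>2)"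

definition p_phase :: "('n spacetime \<Rightarrow> real) \<Rightarrow> real \<Rightarrow> real \<Rightarrow> real \<Rightarrow> 'n spacetime \<Rightarrow> bool" where
  "p_phase a p q \<mu> z \<longleftrightarrow> \<mu> powr p \<ge> a z * \<mu> powr q"

text \<open>
  The alternative between the two cylinder types, both for the underlying cylinder and for the
  Whitney cylinders; dilation by k replaces the radius r by k * r.
\<close>

definition intr_cyl ::
    "('n spacetime \<Rightarrow> real) \<Rightarrow> real \<Rightarrow> real \<Rightarrow> real \<Rightarrow> real \<Rightarrow> 'n::finite spacetime \<Rightarrow> 'n spacetime set" where
  "intr_cyl a p q \<mu> r z = (if p_phase a p q \<mu> z then Q_cyl p \<mu> r z else G_cyl a p q \<mu> r z)"

definition half_time ::
    "('n spacetime \<Rightarrow> real) \<Rightarrow> real \<Rightarrow> real \<Rightarrow> real \<Rightarrow> real \<Rightarrow> 'n spacetime \<Rightarrow> real" where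
  "half_time a p q \<mu> r z =
     (if p_phase a p q \<mu> z then \<mu> powr (2 - p) * r\<^sup>2 else \<mu>\<^sup>2 / H a p q z \<mu> * r\<^sup>2)"

definition p_intrinsic ::
    "real \<Rightarrow> real \<Rightarrow> real \<Rightarrow> real \<Rightarrow> 'n::finite spacetime set \<Rightarrow> ('n spacetime \<Rightarrow> real) \<Rightarrow>
     ('n spacetime \<Rightarrow> real^'n^'m) \<Rightarrow> ('n spacetime \<Rightarrow> real^'n^'m) \<Rightarrow>
     'n spacetime \<Rightarrow> real \<Rightarrow> real \<Rightarrow> bool" where
  "p_intrinsic p q \<alpha> \<delta> S a F Du z0 \<rho> \<pi> \<longleftrightarrow>
     (let f = (\<lambda>z. (H a p q z (norm (Du z)) + H a p q z (norm (F z))) powr \<delta>) in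
      Q_cyl p \<pi> (16 * \<rho>) z0 \<subseteq> S \<and>
      \<pi> powr p \<ge> a z0 * \<pi> powr q \<and>
      \<rho> powr \<alpha> \<le> \<pi> powr (p - q) \<and>
      mean (Q_cyl p \<pi> (16 * \<rho>) z0) f \<le> \<pi> powr (\<delta> * p) \<and>
      \<pi> powr (\<delta> * p) \<le> mean (Q_cyl p \<pi> \<rho> z0) f)"

definition pq_intrinsic ::
    "real \<Rightarrow> real \<Rightarrow> real \<Rightarrow> 'n::finite spacetime set \<Rightarrow> ('n spacetime \<Rightarrow> real) \<Rightarrow>
     ('n spacetime \<Rightarrow> real^'n^'m) \<Rightarrow> ('n spacetime \<Rightarrow> real^'n^'m) \<Rightarrow>
     'n spacetime \<Rightarrow> real \<Rightarrow> real \<Rightarrow> bool" where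
  "pq_intrinsic p q \<delta> S a F Du z0 \<rho> \<pi> \<longleftrightarrow>
     (let f = (\<lambda>z. (H a p q z (norm (Du z)) + H a p q z (norm (F z))) powr \<delta>) in
      G_cyl a p q \<pi> (16 * \<rho>) z0 \<subseteq> S \<and>
      \<pi> powr p < a z0 * \<pi> powr q \<and>
      (\<forall>z \<in> par_cyl (10 * \<rho>) z0 \<inter> S. a z0 / 2 \<le> a z \<and> a z \<le> 2 * a z0) \<and>
      mean (G_cyl a p q \<pi> (16 * \<rho>) z0) f \<le> H a p q z0 \<pi> powr \<delta> \<and>
      H a p q z0 \<pi> powr \<delta> \<le> mean (G_cyl a p q \<pi> \<rho> z0) f)"

definition extend_coeff ::
    "real \<Rightarrow> real \<Rightarrow> 'n::finite spacetime set \<Rightarrow> ('n spacetime \<Rightarrow> real) \<Rightarrow> 'n spacetime \<Rightarrow> real" where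
  "extend_coeff \<alpha> a\<^sub>\<alpha> Q2 a z =
     max (min (INF w\<in>Q2. a w + a\<^sub>\<alpha> * (norm (fst z - fst w) powr \<alpha> + \<bar>snd z - snd w\<bar> powr (\<alpha> / 2)))
              (SUP w\<in>Q2. a w))
         (INF w\<in>Q2. a w)"


subsection \<open>Bad set and Whitney cylinders\<close>

text \<open>The maximal function may be infinite, hence the values in \<^typ>\<open>ennreal\<close>.\<close>

definition maximal :: "('n::finite spacetime \<Rightarrow> real) \<Rightarrow> 'n spacetime \<Rightarrow> ennreal" where
  "maximal f z =
     (SUP Q \<in> {Q. z \<in> Q \<and> (\<exists>w r s. 0 < r \<and> 0 < s \<and> Q = cyl w r s)}.
        (\<integral>\<^sup>+w\<in>Q. ennreal \<bar>f w\<bar> \<partial>lebesgue) / emeasure lebesgue Q)"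

definition ennpowr :: "ennreal \<Rightarrow> real \<Rightarrow> ennreal" where
  "ennpowr x s = (if x = top then top else ennreal (enn2real x powr s))"

definition g_fun ::
    "('n spacetime \<Rightarrow> real^'m) \<Rightarrow> ('n spacetime \<Rightarrow> real^'n^'m) \<Rightarrow> ('n spacetime \<Rightarrow> real^'n^'m) \<Rightarrow>
     real \<Rightarrow> 'n::finite spacetime set \<Rightarrow> 'n spacetime \<Rightarrow> real" where
  "g_fun u Du F \<rho> Q2 z =
     (norm (Du z) + norm (u z - mean Q2 u) / \<rho> + norm (F z)) * indicator Q2 z"

definition Upsilon ::
    "real \<Rightarrow> real \<Rightarrow> ('n spacetime \<Rightarrow> real) \<Rightarrow> ('n::finite spacetime \<Rightarrow> real) \<Rightarrow> 'n spacetime \<Rightarrow> ennreal" where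
  "Upsilon p q a g z =
     ennpowr (maximal (\<lambda>w. g w powr (q - 1) + (a w * g w powr q) powr ((q - 1) / p)) z) (p / (q - 1))"

definition good_set ::
    "real \<Rightarrow> real \<Rightarrow> ('n spacetime \<Rightarrow> real) \<Rightarrow> ('n::finite spacetime \<Rightarrow> real) \<Rightarrow> real \<Rightarrow> 'n spacetime set" where
  "good_set p q a g \<Lambda> = {z. Upsilon p q a g z \<le> ennreal \<Lambda>}"

definition lam :: "('n spacetime \<Rightarrow> real) \<Rightarrow> real \<Rightarrow> real \<Rightarrow> real \<Rightarrow> 'n spacetime \<Rightarrow> real" where
  "lam a p q \<Lambda> z = (THE \<mu>. 0 < \<mu> \<and> \<mu> powr p + a z * \<mu> powr q = \<Lambda>)"

definition intr_dist ::
    "('n spacetime \<Rightarrow> real) \<Rightarrow> real \<Rightarrow> real \<Rightarrow> real \<Rightarrow> 'n::finite spacetime \<Rightarrow>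
     'n spacetime \<Rightarrow> 'n spacetime \<Rightarrow> real" where
  "intr_dist a p q \<Lambda> z z1 z2 =
     (let \<mu> = lam a p q \<Lambda> z in
      if p_phase a p q \<mu> z
      then max (norm (fst z1 - fst z2)) (sqrt (\<mu> powr (p - 2) * \<bar>snd z1 - snd z2\<bar>))
      else max (norm (fst z1 - fst z2)) (sqrt (\<Lambda> * \<mu> powr (-2) * \<bar>snd z1 - snd z2\<bar>)))"

definition whitney_radius ::
    "('n spacetime \<Rightarrow> real) \<Rightarrow> real \<Rightarrow> real \<Rightarrow> real \<Rightarrow> 'n::finite spacetime set \<Rightarrow> 'n spacetime \<Rightarrow> real" where
  "whitney_radius a p q \<Lambda> E z = (INF w\<in>E. intr_dist a p q \<Lambda> z z w) / 4"

text \<open>The dilated cylinder \<open>k U\<^sub>z\<close>.\<close>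

definition whitney_cyl ::
    "('n spacetime \<Rightarrow> real) \<Rightarrow> real \<Rightarrow> real \<Rightarrow> real \<Rightarrow> 'n::finite spacetime set \<Rightarrow>
     real \<Rightarrow> 'n spacetime \<Rightarrow> 'n spacetime set" where
  "whitney_cyl a p q \<Lambda> E k z = intr_cyl a p q (lam a p q \<Lambda> z) (k * whitney_radius a p q \<Lambda> E z) z"

definition whitney_covering ::
    "('n spacetime \<Rightarrow> real) \<Rightarrow> real \<Rightarrow> real \<Rightarrow> real \<Rightarrow> real \<Rightarrow> real \<Rightarrow> 'n::finite spacetime set \<Rightarrow>
     (nat \<Rightarrow> 'n spacetime) \<Rightarrow> bool" where
  "whitney_covering a p q \<alpha> a\<^sub>\<alpha> \<Lambda> E \<zeta> \<longleftrightarrow>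
     (let U = (\<lambda>k i. whitney_cyl a p q \<Lambda> E k (\<zeta> i));
          r = (\<lambda>i. whitney_radius a p q \<Lambda> E (\<zeta> i));
          \<mu> = (\<lambda>i. lam a p q \<Lambda> (\<zeta> i))
      in (\<forall>i. \<zeta> i \<in> - E) \<and>
         (\<Union>i. U 1 i) = - E \<and>
         disjoint_family (U (1 / 8)) \<and>
         (\<forall>i. U 4 i \<subseteq> - E) \<and>
         (\<forall>i. U 5 i \<inter> E \<noteq> {}) \<and>
         (\<forall>i. p_phase a p q (\<mu> i) (\<zeta> i) \<longrightarrow>
            r i powr \<alpha> * \<mu> i powr q \<le> 1 / (800 * (1 + a\<^sub>\<alpha>)) * \<mu> i powr p) \<and>
         (\<forall>i. \<not> p_phase a p q (\<mu> i) (\<zeta> i) \<longrightarrow>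
            (\<forall>z \<in> par_cyl (200 * r i) (\<zeta> i). a (\<zeta> i) / 2 \<le> a z \<and> a z \<le> 2 * a (\<zeta> i))))"


subsection \<open>Index sets\<close>

definition strip :: "real \<Rightarrow> real \<Rightarrow> 'n::finite spacetime set" where
  "strip t0 s = UNIV \<times> {t0 - s<..<t0 + s}"

definition Theta :: "(nat \<Rightarrow> 'n spacetime set) \<Rightarrow> 'n spacetime set \<Rightarrow> nat set" where
  "Theta U50 C1 = {i. U50 i \<inter> C1 \<noteq> {}}"

definition Theta1 ::
    "(nat \<Rightarrow> 'n spacetime set) \<Rightarrow> 'n spacetime set \<Rightarrow> 'n spacetime set \<Rightarrow> nat set" where
  "Theta1 U50 C1 C2 = {i \<in> Theta U50 C1. U50 i \<subseteq> C2}"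

definition Theta2 ::
    "(nat \<Rightarrow> 'n spacetime set) \<Rightarrow> 'n spacetime set \<Rightarrow> 'n spacetime set \<Rightarrow> nat set" where
  "Theta2 U50 C1 C2 = Theta U50 C1 - Theta1 U50 C1 C2"

end

theory Submission
  imports Defs
begin

text \<open>
  A cylinder \<open>50 U\<^sub>i\<close> with \<open>i \<in> \<Theta>\<^sub>2\<close> meets \<open>\<C>\<^sub>1\<close> and leaves \<open>\<C>\<^sub>2\<close>, so its time length, which is
  comparable to \<open>\<lambda>\<^sub>i\<^sup>2 r\<^sub>i\<^sup>2 / \<Lambda>\<close>, is at least \<open>(\<sigma>\<^sub>2 - \<sigma>\<^sub>1) / 5\<close>, and
  \<open>\<sigma>\<^sub>2 - \<sigma>\<^sub>1 \<ge> (\<pi>\<^sup>2 / \<Pi>) (\<rho>\<^sub>2 - \<rho>\<^sub>1)\<^sup>2\<close>. The extended coefficient takes values between the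
  extrema of \<open>a\<close> on \<open>\<Q>\<^sub>2\<close>, so the intrinsic conditions make \<open>\<pi>\<^sup>p + a(z\<^sub>i) \<pi>\<^sup>q\<close> comparable to \<open>\<Pi>\<close>.
  With \<open>\<Lambda> \<ge> \<theta> \<Pi>\<close> this gives \<open>\<lambda>\<^sub>i \<ge> s \<pi>\<close> for \<open>s\<close> comparable to \<open>\<theta>\<close> to the power \<open>1 / p\<close>, and
  since \<open>H(z\<^sub>i, \<lambda>) / \<lambda>\<^sup>2\<close> increases with \<open>\<lambda>\<close>, the quotient \<open>\<Lambda> / \<lambda>\<^sub>i\<^sup>2\<close> is at least
  \<open>\<Pi> / \<pi>\<^sup>2\<close> times a constant multiple of \<open>\<theta>\<close> to the power \<open>(q - 2) / p\<close>.
\<close>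

section \<open>The double phase function: roots and growth\<close>

lemma double_phase_strict_mono:
  fixes b p q x y :: real
  assumes "0 \<le> b" "0 < p" "0 < q" "0 \<le> x" "x < y"
  shows "x powr p + b * x powr q < y powr p + b * y powr q"
  using assms by (intro add_less_le_mono mult_left_mono powr_mono2 powr_less_mono2) auto

text \<open>This is what makes the definite description in \<open>lam\<close> denote the
  root.\<close>

lemma double_phase_root_ex1:
  fixes b p q \<Lambda> :: real
  assumes "0 \<le> b" "0 < p" "0 < q" "0 < \<Lambda>"
  shows "\<exists>!\<mu>. 0 < \<mu> \<and> \<mu> powr p + b * \<mu> powr q = \<Lambda>"
proof -
  define f where "f = (\<lambda>\<mu>. \<mu> powr p + b * \<mu> powr q)"
  \<comment> \<open>Right end point for the intermediate value theorem: the \<open>p\<close>-term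
    alone reaches \<open>\<Lambda>\<close> there.\<close>
  define y where "y = \<Lambda> powr (1 / p)"
  have y: "0 < y" "y powr p = \<Lambda>"
    using assms by (auto simp: y_def powr_powr)
  have cont: "continuous_on {0..y} f"
    unfolding f_def using assms by (intro continuous_intros continuous_on_powr') auto
  have "f 0 \<le> \<Lambda>" "\<Lambda> \<le> f y"
    using assms y by (auto simp: f_def)
  then obtain \<mu> where \<mu>: "0 \<le> \<mu>" "f \<mu> = \<Lambda>"
    using IVT'[of f 0 \<Lambda> y] cont y by auto
  have "\<mu> \<noteq> 0"
    using \<mu> assms by (auto simp: f_def)
  with \<mu> have ex: "0 < \<mu> \<and> \<mu> powr p + b * \<mu> powr q = \<Lambda>"
    by (auto simp: f_def)
  show ?thesis
  proof (rule ex1I)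
    show "0 < \<mu> \<and> \<mu> powr p + b * \<mu> powr q = \<Lambda>"
      by (fact ex)
  next
    fix \<nu> assume "0 < \<nu> \<and> \<nu> powr p + b * \<nu> powr q = \<Lambda>"
    then show "\<nu> = \<mu>"
      using ex double_phase_strict_mono[OF assms(1-3), of \<nu> \<mu>]
        double_phase_strict_mono[OF assms(1-3), of \<mu> \<nu>]
      by (cases \<nu> \<mu> rule: linorder_cases) auto
  qed
qed

lemma lam_eq:
  assumes "0 \<le> a z" "0 < p" "0 < q" "0 < \<Lambda>"
  shows "0 < lam a p q \<Lambda> z" "H a p q z (lam a p q \<Lambda> z) = \<Lambda>"
  using theI'[OF double_phase_root_ex1[OF assms]] by (auto simp: lam_def H_def)

text \<open>Scaling the argument by \<open>s \<le> 1\<close> multiplies the value by at most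
  \<open>s powr p\<close>, because the \<open>q\<close>-term shrinks even more. With
  \<open>s powr p = \<theta> / (1 + K)\<close>, any \<open>\<mu>\<close> below
  \<open>s * \<pi>\<close> would have a value below \<open>\<theta> * P\<close>.\<close>

lemma double_phase_root_lower:
  fixes b p q \<theta> K P \<pi> \<mu> :: real
  assumes "0 \<le> b" "0 < p" "p \<le> q" "0 < \<theta>" "\<theta> \<le> 1 + K" "0 \<le> K" "0 < \<pi>" "0 < \<mu>"
    and upper: "\<pi> powr p + b * \<pi> powr q \<le> (1 + K) * P"
    and \<mu>: "\<theta> * P \<le> \<mu> powr p + b * \<mu> powr q"
  shows "(\<theta> / (1 + K)) powr (1 / p) * \<pi> \<le> \<mu>"
proof (rule ccontr)
  define s where "s = (\<theta> / (1 + K)) powr (1 / p)"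
  have s: "0 < s" "s \<le> 1" "s powr p = \<theta> / (1 + K)"
    using assms by (auto simp: s_def powr_powr intro!: powr_le1)
  have sq: "s powr q \<le> s powr p"
    using s assms by (intro powr_mono') auto
  assume "\<not> (\<theta> / (1 + K)) powr (1 / p) * \<pi> \<le> \<mu>"
  then have "\<mu> powr p + b * \<mu> powr q < (s * \<pi>) powr p + b * (s * \<pi>) powr q"
    using assms by (intro double_phase_strict_mono) (auto simp: s_def)
  also have "\<dots> = s powr p * \<pi> powr p + s powr q * (b * \<pi> powr q)"
    using s assms by (simp add: powr_mult)
  also have "\<dots> \<le> s powr p * \<pi> powr p + s powr p * (b * \<pi> powr q)"
    using sq assms by (intro add_left_mono mult_right_mono) auto
  also have "\<dots> = s powr p * (\<pi> powr p + b * \<pi> powr q)"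
    by (simp add: distrib_left)
  also have "\<dots> \<le> \<theta> / (1 + K) * ((1 + K) * P)"
    unfolding s(3) using upper assms by (intro mult_left_mono) auto
  also have "\<dots> = \<theta> * P"
    using assms by simp
  finally show False
    using \<mu> by simp
qed

text \<open>Division by the square leaves the nonnegative exponents \<open>p - 2\<close> and
  \<open>q - 2\<close>, so the quotient is monotone. Scaling the argument by
  \<open>s \<le> 1\<close> then costs at most the smaller factor
  \<open>s powr (q - 2)\<close>.\<close>

lemma double_phase_quotient_lower:
  fixes b p q s \<pi> \<mu> :: real
  assumes "0 \<le> b" "2 \<le> p" "p \<le> q" "0 < s" "s \<le> 1" "0 < \<pi>" "s * \<pi> \<le> \<mu>"
  shows "s powr (q - 2) * (\<pi> powr p + b * \<pi> powr q) / \<pi>\<^sup>2 \<le> (\<mu> powr p + b * \<mu> powr q) / \<mu>\<^sup>2"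
proof -
  have "0 < \<mu>"
    using assms mult_pos_pos[of s \<pi>] by linarith
  have quot: "(x powr p + b * x powr q) / x\<^sup>2 = x powr (p - 2) + b * x powr (q - 2)" if "0 < x" for x :: real
    using that by (simp add: powr_diff add_divide_distrib)
  have sq: "s powr (q - 2) \<le> s powr (p - 2)"
    using assms by (intro powr_mono') auto
  have "s powr (q - 2) * (\<pi> powr p + b * \<pi> powr q) / \<pi>\<^sup>2
      = s powr (q - 2) * \<pi> powr (p - 2) + s powr (q - 2) * (b * \<pi> powr (q - 2))"
    using quot[OF \<open>0 < \<pi>\<close>] by (metis distrib_left times_divide_eq_right)
  also have "\<dots> \<le> s powr (p - 2) * \<pi> powr (p - 2) + s powr (q - 2) * (b * \<pi> powr (q - 2))"
    using sq by (intro add_right_mono mult_right_mono) auto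
  also have "\<dots> = (s * \<pi>) powr (p - 2) + b * (s * \<pi>) powr (q - 2)"
    using assms by (simp add: powr_mult)
  also have "\<dots> \<le> \<mu> powr (p - 2) + b * \<mu> powr (q - 2)"
    using assms by (intro add_mono mult_left_mono powr_mono2) auto
  also have "\<dots> = (\<mu> powr p + b * \<mu> powr q) / \<mu>\<^sup>2"
    using quot[OF \<open>0 < \<mu>\<close>] by simp
  finally show ?thesis .
qed

section \<open>Cylinder geometry, truncation of the coefficient, index set\<close>

lemma intr_cyl_eq: "intr_cyl a p q \<mu> r z = cyl z r (half_time a p q \<mu> r z)"
  by (simp add: intr_cyl_def half_time_def Q_cyl_def G_cyl_def)

lemma cyl_mono: "r \<le> r' \<Longrightarrow> s \<le> s' \<Longrightarrow> cyl z r s \<subseteq> cyl z r' s'"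
  by (auto simp: cyl_def)

lemma half_time_factor: "half_time a p q \<mu> r z = half_time a p q \<mu> 1 z * r\<^sup>2"
  by (simp add: half_time_def)

text \<open>One comparison quantity for both cylinder types: it is exact for the
  \<open>G\<close>-type, while in the \<open>p\<close>-phase \<open>H\<close> lies between
  \<open>\<mu> powr p\<close> and twice that.\<close>

lemma half_time_bounds:
  assumes "0 \<le> a z" "0 < \<mu>"
  shows "\<mu>\<^sup>2 / H a p q z \<mu> \<le> half_time a p q \<mu> 1 z"
    and "half_time a p q \<mu> 1 z \<le> 2 * (\<mu>\<^sup>2 / H a p q z \<mu>)"
proof -
  have pos: "0 < \<mu> powr p" "0 < H a p q z \<mu>" "\<mu> powr p \<le> H a p q z \<mu>"
    using assms by (auto simp: H_def add_pos_nonneg)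
  have eq: "\<mu> powr (2 - p) = \<mu>\<^sup>2 / \<mu> powr p"
    using assms by (simp add: powr_diff)
  have "\<mu>\<^sup>2 / H a p q z \<mu> \<le> \<mu>\<^sup>2 / \<mu> powr p"
    using pos by (intro divide_left_mono) auto
  then show "\<mu>\<^sup>2 / H a p q z \<mu> \<le> half_time a p q \<mu> 1 z"
    by (simp add: half_time_def eq)
  have "\<mu>\<^sup>2 / \<mu> powr p \<le> 2 * (\<mu>\<^sup>2 / H a p q z \<mu>)" if "p_phase a p q \<mu> z"
  proof -
    have "H a p q z \<mu> \<le> 2 * \<mu> powr p"
      using that by (simp add: p_phase_def H_def)
    then have "\<mu>\<^sup>2 * H a p q z \<mu> \<le> \<mu>\<^sup>2 * (2 * \<mu> powr p)"
      by (intro mult_left_mono) auto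
    then show ?thesis
      using pos by (simp add: field_simps)
  qed
  then show "half_time a p q \<mu> 1 z \<le> 2 * (\<mu>\<^sup>2 / H a p q z \<mu>)"
    using divide_nonneg_pos[OF zero_le_power2 pos(2), of \<mu>] by (simp add: half_time_def eq)
qed

text \<open>The extension is truncated between the extrema of \<open>a\<close> on \<open>Q\<close>,
  so bounds on \<open>Q\<close> pass to every \<open>z\<close>, also outside
  \<open>Q\<close>.\<close>

lemma extend_coeff_bounds:
  assumes "Q \<noteq> {}" "\<And>w. w \<in> Q \<Longrightarrow> l \<le> a w" "\<And>w. w \<in> Q \<Longrightarrow> a w \<le> h"
  shows "l \<le> extend_coeff \<alpha> a\<^sub>\<alpha> Q a z" "extend_coeff \<alpha> a\<^sub>\<alpha> Q a z \<le> h"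
proof -
  have l: "l \<le> (INF w\<in>Q. a w)"
    using assms by (intro cINF_greatest) auto
  have h: "(SUP w\<in>Q. a w) \<le> h"
    using assms by (intro cSUP_least) auto
  obtain w where "w \<in> Q"
    using assms by auto
  \<comment> \<open>The outermost operation of the truncation is a maximum with the infimum, so the
    upper bound requires the infimum to be at most \<open>h\<close> as well.\<close>
  have "(INF w\<in>Q. a w) \<le> a w"
    using assms \<open>w \<in> Q\<close> by (intro cINF_lower bdd_belowI2[where m = l]) auto
  also have "\<dots> \<le> h"
    using assms \<open>w \<in> Q\<close> by auto
  finally have i: "(INF w\<in>Q. a w) \<le> h" .
  show "l \<le> extend_coeff \<alpha> a\<^sub>\<alpha> Q a z" "extend_coeff \<alpha> a\<^sub>\<alpha> Q a z \<le> h"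
    using l h i by (auto simp: extend_coeff_def)
qed

text \<open>Some time in the cylinder is closer than \<open>s1\<close> to \<open>t0\<close>, another
  has distance at least \<open>s2\<close>, and both lie in one open interval of length
  \<open>2 * \<tau> i\<close>. Nonemptiness of the cylinder gives the positive radius.\<close>

lemma Theta2_half_time:
  assumes "i \<in> Theta2 (\<lambda>i. cyl (\<zeta> i) (R i) (\<tau> i)) (strip t0 s1) (strip t0 s2)"
  shows "0 < R i" "s2 - s1 < 2 * \<tau> i"
proof -
  obtain v w where v: "v \<in> cyl (\<zeta> i) (R i) (\<tau> i)" "v \<in> strip t0 s1"
    and w: "w \<in> cyl (\<zeta> i) (R i) (\<tau> i)" "w \<notin> strip t0 s2"
    using assms by (auto simp: Theta2_def Theta_def Theta1_def)
  show "0 < R i"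
    using v by (auto simp: cyl_def intro: le_less_trans[OF zero_le_dist])
  show "s2 - s1 < 2 * \<tau> i"
    using v w by (cases v; cases w) (auto simp: cyl_def strip_def)
qed

section \<open>The coefficient under the intrinsic conditions\<close>

text \<open>The phase condition bounds \<open>a z0\<close> by \<open>\<pi> powr (p - q)\<close>. The
  Hoelder oscillation around \<open>z0\<close> is of order \<open>\<rho> powr \<alpha>\<close>,
  which the radius condition bounds by the same power.\<close>

lemma p_intrinsic_coeff_le:
  fixes S :: "'n::finite spacetime set"
  assumes adm: "admissible_coefficient \<alpha> a\<^sub>\<alpha> S a"
    and "p_intrinsic p q \<alpha> \<delta> S a F Du z0 \<rho> \<pi>"
    and "0 < \<alpha>" "\<alpha> \<le> 1" "2 < p" "0 \<le> a\<^sub>\<alpha>" "z0 \<in> S" "0 < \<rho>" "1 < \<pi>" "\<rho>2 \<le> 4 * \<rho>" "0 < \<rho>2"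
    and w: "w \<in> Q_cyl p \<pi> \<rho>2 z0"
  shows "w \<in> S" "a w \<le> (1 + 4 * a\<^sub>\<alpha>) * \<pi> powr (p - q)"
proof -
  have sub: "Q_cyl p \<pi> (16 * \<rho>) z0 \<subseteq> S" and ph: "a z0 * \<pi> powr q \<le> \<pi> powr p"
    and rad: "\<rho> powr \<alpha> \<le> \<pi> powr (p - q)"
    using assms(2) by (auto simp: p_intrinsic_def Let_def)
  have sq: "\<rho>2\<^sup>2 \<le> (4 * \<rho>)\<^sup>2" "\<rho>2\<^sup>2 \<le> (16 * \<rho>)\<^sup>2"
    using assms by (intro power_mono; linarith)+
  have "Q_cyl p \<pi> \<rho>2 z0 \<subseteq> Q_cyl p \<pi> (16 * \<rho>) z0"
    unfolding Q_cyl_def using assms sq by (intro cyl_mono mult_left_mono) auto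
  with w sub show wS: "w \<in> S"
    by auto
  \<comment> \<open>The intrinsic time length is at most the parabolic one, so the spatial and the
    temporal Hoelder terms are both at most \<open>(4 * \<rho>) powr \<alpha>\<close>.\<close>
  have "\<pi> powr (2 - p) \<le> \<pi> powr 0"
    using assms by (intro powr_mono) auto
  then have "\<pi> powr (2 - p) \<le> 1"
    using assms by simp
  then have "\<pi> powr (2 - p) * \<rho>2\<^sup>2 \<le> 1 * (4 * \<rho>)\<^sup>2"
    using sq by (intro mult_mono) auto
  then have t: "\<bar>snd w - snd z0\<bar> \<le> (4 * \<rho>)\<^sup>2" and x: "norm (fst w - fst z0) \<le> 4 * \<rho>"
    using w assms by (auto simp: Q_cyl_def cyl_def dist_norm norm_minus_commute)
  have "norm (fst w - fst z0) powr \<alpha> \<le> (4 * \<rho>) powr \<alpha>"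
    using x assms by (intro powr_mono2) auto
  moreover have "\<bar>snd w - snd z0\<bar> powr (\<alpha> / 2) \<le> ((4 * \<rho>)\<^sup>2) powr (\<alpha> / 2)"
    using t assms by (intro powr_mono2) auto
  moreover have "((4 * \<rho>)\<^sup>2) powr (\<alpha> / 2) = (4 * \<rho>) powr \<alpha>"
    using assms powr_powr[of "4 * \<rho>" 2 "\<alpha> / 2"] by simp
  moreover have "\<bar>a w - a z0\<bar> \<le> a\<^sub>\<alpha> * max (norm (fst w - fst z0) powr \<alpha>) (\<bar>snd w - snd z0\<bar> powr (\<alpha> / 2))"
    using adm wS \<open>z0 \<in> S\<close> unfolding admissible_coefficient_def
    by (cases w; cases z0) fastforce
  ultimately have "\<bar>a w - a z0\<bar> \<le> a\<^sub>\<alpha> * (4 * \<rho>) powr \<alpha>"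
    using \<open>0 \<le> a\<^sub>\<alpha>\<close> by (elim order_trans) (auto intro!: mult_left_mono)
  also have "(4 * \<rho>) powr \<alpha> \<le> 4 * \<rho> powr \<alpha>"
    using assms powr_mono[of \<alpha> 1 "4::real"] by (auto simp: powr_mult intro!: mult_right_mono)
  also have "\<dots> \<le> 4 * \<pi> powr (p - q)"
    using rad by simp
  finally have "\<bar>a w - a z0\<bar> \<le> a\<^sub>\<alpha> * (4 * \<pi> powr (p - q))"
    using \<open>0 \<le> a\<^sub>\<alpha>\<close> by (simp add: mult_left_mono)
  moreover have "a z0 \<le> \<pi> powr (p - q)"
    using ph assms by (simp add: powr_diff field_simps)
  ultimately show "a w \<le> (1 + 4 * a\<^sub>\<alpha>) * \<pi> powr (p - q)"
    by (simp add: algebra_simps)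
qed

text \<open>The assumed comparability holds on \<open>par_cyl (10 * \<rho>) z0\<close> within
  \<open>S\<close>; the work is to place the intrinsic cylinder in both sets.\<close>

lemma pq_intrinsic_coeff_comparable:
  fixes S :: "'n::finite spacetime set"
  assumes "pq_intrinsic p q \<delta> S a F Du z0 \<rho> \<pi>"
    and "2 < p" "0 \<le> a z0" "0 < \<rho>" "1 < \<pi>" "\<rho>2 \<le> 4 * \<rho>" "0 < \<rho>2"
    and w: "w \<in> G_cyl a p q \<pi> \<rho>2 z0"
  shows "w \<in> S" "a z0 / 2 \<le> a w" "a w \<le> 2 * a z0"
proof -
  have sub: "G_cyl a p q \<pi> (16 * \<rho>) z0 \<subseteq> S"
    and comp: "\<forall>z \<in> par_cyl (10 * \<rho>) z0 \<inter> S. a z0 / 2 \<le> a z \<and> a z \<le> 2 * a z0"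
    using assms(1) by (auto simp: pq_intrinsic_def Let_def)
  have sq: "\<rho>2\<^sup>2 \<le> (10 * \<rho>)\<^sup>2" "\<rho>2\<^sup>2 \<le> (16 * \<rho>)\<^sup>2"
    using assms by (intro power_mono; linarith)+
  \<comment> \<open>Aim: the time factor of the \<open>G\<close>-cylinder is at most 1.\<close>
  have "\<pi> powr 2 \<le> \<pi> powr p"
    using assms by (intro powr_mono) auto
  also have "\<dots> \<le> H a p q z0 \<pi>"
    using assms by (simp add: H_def)
  finally have "\<pi>\<^sup>2 \<le> H a p q z0 \<pi>"
    using assms by simp
  moreover from this have "0 < H a p q z0 \<pi>"
    using assms zero_less_power[of \<pi> 2] by linarith
  ultimately have k: "0 \<le> \<pi>\<^sup>2 / H a p q z0 \<pi>" "\<pi>\<^sup>2 / H a p q z0 \<pi> \<le> 1"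
    by simp_all
  have "G_cyl a p q \<pi> \<rho>2 z0 \<subseteq> G_cyl a p q \<pi> (16 * \<rho>) z0"
    unfolding G_cyl_def using assms sq k by (intro cyl_mono mult_left_mono) auto
  with w sub show wS: "w \<in> S"
    by auto
  have "\<pi>\<^sup>2 / H a p q z0 \<pi> * \<rho>2\<^sup>2 \<le> 1 * (10 * \<rho>)\<^sup>2"
    using sq k by (intro mult_mono) auto
  then have "G_cyl a p q \<pi> \<rho>2 z0 \<subseteq> par_cyl (10 * \<rho>) z0"
    unfolding G_cyl_def par_cyl_def using assms by (intro cyl_mono) auto
  with w wS comp show "a z0 / 2 \<le> a w" "a w \<le> 2 * a z0"
    by auto
qed

text \<open>One pair of constants serves both cases: the upper bound needs
  \<open>2 + 4 * a\<^sub>\<alpha>\<close> in the \<open>p\<close>-intrinsic case and 2 in the other.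
  The point \<open>z\<close> is arbitrary, so Whitney centres outside the underlying cylinder are
  covered.\<close>

lemma extend_coeff_intrinsic:
  fixes S :: "'n::finite spacetime set" and z :: "'n spacetime"
  assumes adm: "admissible_coefficient \<alpha> a\<^sub>\<alpha> S a"
    and intr: "p_intrinsic p q \<alpha> \<delta> S a F Du z0 \<rho> \<pi> \<or> pq_intrinsic p q \<delta> S a F Du z0 \<rho> \<pi>"
    and "0 < \<alpha>" "\<alpha> \<le> 1" "2 < p" "0 \<le> a\<^sub>\<alpha>" "z0 \<in> S" "0 < \<rho>" "1 < \<pi>" "\<rho>2 \<le> 4 * \<rho>" "0 < \<rho>2"
  defines "b \<equiv> extend_coeff \<alpha> a\<^sub>\<alpha> (intr_cyl a p q \<pi> \<rho>2 z0) a z"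
  shows "0 \<le> b" "\<pi> powr p + b * \<pi> powr q \<le> (1 + (2 + 4 * a\<^sub>\<alpha>)) * H a p q z0 \<pi>"
    "H a p q z0 \<pi> \<le> 2 * (\<pi> powr p + b * \<pi> powr q)"
proof -
  have a0: "0 \<le> a z0" and nn: "\<And>w. w \<in> S \<Longrightarrow> 0 \<le> a w"
    using adm \<open>z0 \<in> S\<close> by (auto simp: admissible_coefficient_def)
  define X where "X = \<pi> powr q"
  have X: "0 < X" and Y: "0 < \<pi> powr p"
    using assms by (auto simp: X_def)
  have aX: "0 \<le> a z0 * X"
    using a0 X by simp
  have "0 < half_time a p q \<pi> \<rho>2 z0"
    using assms a0 by (auto simp: half_time_def H_def add_pos_nonneg)
  then have ne: "intr_cyl a p q \<pi> \<rho>2 z0 \<noteq> {}"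
    using assms by (auto simp: intr_cyl_eq cyl_def)
  have "0 \<le> b \<and> \<pi> powr p + b * X \<le> (1 + (2 + 4 * a\<^sub>\<alpha>)) * (\<pi> powr p + a z0 * X) \<and>
    \<pi> powr p + a z0 * X \<le> 2 * (\<pi> powr p + b * X)"
    using intr
  proof
    assume p: "p_intrinsic p q \<alpha> \<delta> S a F Du z0 \<rho> \<pi>"
    then have ph: "a z0 * X \<le> \<pi> powr p"
      by (auto simp: p_intrinsic_def Let_def X_def)
    then have Q: "intr_cyl a p q \<pi> \<rho>2 z0 = Q_cyl p \<pi> \<rho>2 z0"
      by (simp add: intr_cyl_def p_phase_def X_def)
    note le = p_intrinsic_coeff_le[OF adm p assms(3-11)]
    have b: "0 \<le> b" "b \<le> (1 + 4 * a\<^sub>\<alpha>) * \<pi> powr (p - q)"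
      unfolding b_def Q using le nn by (intro extend_coeff_bounds[OF ne[unfolded Q]]; blast)+
    have "b * X \<le> (1 + 4 * a\<^sub>\<alpha>) * \<pi> powr (p - q) * X"
      using b X by (intro mult_right_mono) auto
    also have "\<dots> = (1 + 4 * a\<^sub>\<alpha>) * \<pi> powr p"
      using assms by (simp add: X_def powr_diff)
    finally have "b * X \<le> (1 + 4 * a\<^sub>\<alpha>) * \<pi> powr p" .
    moreover have "0 \<le> b * X" "0 \<le> a\<^sub>\<alpha> * (a z0 * X)"
      using b X aX assms by auto
    ultimately show ?thesis
      using b ph aX Y by (simp add: algebra_simps)
  next
    assume pq: "pq_intrinsic p q \<delta> S a F Du z0 \<rho> \<pi>"
    then have Q: "intr_cyl a p q \<pi> \<rho>2 z0 = G_cyl a p q \<pi> \<rho>2 z0"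
      by (auto simp: pq_intrinsic_def Let_def intr_cyl_def p_phase_def)
    note le = pq_intrinsic_coeff_comparable[OF pq \<open>2 < p\<close> a0 assms(8-11)]
    have b: "a z0 / 2 \<le> b" "b \<le> 2 * a z0"
      unfolding b_def Q using le by (intro extend_coeff_bounds[OF ne[unfolded Q]]; blast)+
    have "b * X \<le> 2 * (a z0 * X)" "(a z0 * X) / 2 \<le> b * X"
      using mult_right_mono[OF b(1), of X] mult_right_mono[OF b(2), of X] X by auto
    moreover have "(1 + (2 + 4 * a\<^sub>\<alpha>)) * (\<pi> powr p + a z0 * X) =
        3 * \<pi> powr p + 3 * (a z0 * X) + 4 * (a\<^sub>\<alpha> * \<pi> powr p) + 4 * (a\<^sub>\<alpha> * (a z0 * X))"
      by (simp add: algebra_simps)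
    moreover have "0 \<le> a\<^sub>\<alpha> * \<pi> powr p" "0 \<le> a\<^sub>\<alpha> * (a z0 * X)"
      using aX assms by auto
    ultimately have "\<pi> powr p + b * X \<le> (1 + (2 + 4 * a\<^sub>\<alpha>)) * (\<pi> powr p + a z0 * X)"
      "\<pi> powr p + a z0 * X \<le> 2 * (\<pi> powr p + b * X)"
      using aX Y by argo+
    moreover have "0 \<le> b"
      using b a0 by linarith
    ultimately show ?thesis
      by blast
  qed
  then show "0 \<le> b" "\<pi> powr p + b * \<pi> powr q \<le> (1 + (2 + 4 * a\<^sub>\<alpha>)) * H a p q z0 \<pi>"
    "H a p q z0 \<pi> \<le> 2 * (\<pi> powr p + b * \<pi> powr q)"
    by (auto simp: H_def X_def)
qed

section \<open>From time lengths to radii\<close>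

lemma intrinsic_radius_gap:
  fixes b p q \<theta> K P \<Lambda> \<pi> \<mu> r d :: real
  assumes "0 \<le> b" "2 < p" "p < q" "0 < \<theta>" "\<theta> < 1" "0 \<le> K" "0 < \<pi>" "0 < \<mu>" "0 < r" "0 < P"
    and upper: "\<pi> powr p + b * \<pi> powr q \<le> (1 + K) * P"
    and lower: "P \<le> 2 * (\<pi> powr p + b * \<pi> powr q)"
    and \<mu>: "\<mu> powr p + b * \<mu> powr q = \<Lambda>" "\<theta> * P \<le> \<Lambda>"
    and gap: "\<pi>\<^sup>2 / P * d\<^sup>2 \<le> 50000 * r\<^sup>2 * (\<mu>\<^sup>2 / \<Lambda>)"
  shows "d \<le> 400 * (1 + K) powr ((q - 2) / p) * \<theta> powr ((2 - q) / p) * r"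
proof -
  define s where "s = (\<theta> / (1 + K)) powr (1 / p)"
  \<comment> \<open>\<open>X\<close> is the reciprocal of \<open>s powr (q - 2)\<close>, the loss in
    the quotient estimate.\<close>
  define X where "X = (1 + K) powr ((q - 2) / p) * \<theta> powr ((2 - q) / p)"
  have s: "0 < s" "s \<le> 1"
    using assms by (auto simp: s_def intro!: powr_le1)
  have sX: "s powr (q - 2) * X = 1"
    using assms powr_minus[of \<theta> "(q - 2) / p"]
    by (simp add: s_def X_def powr_powr powr_divide minus_divide_left)
  have "s powr (q - 2) \<le> 1"
    using s assms by (intro powr_le1) auto
  moreover have "0 < X"
    using assms by (simp add: X_def)
  ultimately have X: "1 \<le> X"
    using sX mult_right_mono[of "s powr (q - 2)" 1 X] by simp
  have "s * \<pi> \<le> \<mu>"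
    unfolding s_def using assms by (intro double_phase_root_lower[where b = b and P = P and q = q]) auto
  then have "s powr (q - 2) * (\<pi> powr p + b * \<pi> powr q) / \<pi>\<^sup>2 \<le> \<Lambda> / \<mu>\<^sup>2"
    using double_phase_quotient_lower[of b p q s \<pi> \<mu>] assms s by simp
  moreover have "s powr (q - 2) * (P / 2) / \<pi>\<^sup>2 \<le> s powr (q - 2) * (\<pi> powr p + b * \<pi> powr q) / \<pi>\<^sup>2"
    using lower by (intro divide_right_mono mult_left_mono) auto
  ultimately have quot: "s powr (q - 2) * (P / 2) / \<pi>\<^sup>2 \<le> \<Lambda> / \<mu>\<^sup>2"
    by linarith
  have L: "0 < \<Lambda>"
    using assms mult_pos_pos[of \<theta> P] by linarith
  have "X * (s powr (q - 2) * (P / 2) / \<pi>\<^sup>2) \<le> X * (\<Lambda> / \<mu>\<^sup>2)"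
    using quot X by (intro mult_left_mono) auto
  then have "P / (2 * \<pi>\<^sup>2) \<le> X * (\<Lambda> / \<mu>\<^sup>2)"
    using sX by (simp add: mult.assoc[symmetric] mult.commute[of X])
  then have "\<mu>\<^sup>2 / \<Lambda> \<le> 2 * X * (\<pi>\<^sup>2 / P)"
    using assms L X by (simp add: field_simps)
  then have "50000 * r\<^sup>2 * (\<mu>\<^sup>2 / \<Lambda>) \<le> 50000 * r\<^sup>2 * (2 * X * (\<pi>\<^sup>2 / P))"
    by (intro mult_left_mono) auto
  with gap have "\<pi>\<^sup>2 / P * d\<^sup>2 \<le> \<pi>\<^sup>2 / P * (100000 * X * r\<^sup>2)"
    by (simp add: mult_ac)
  then have "d\<^sup>2 \<le> 100000 * X * r\<^sup>2"
    using assms by (subst (asm) mult_le_cancel_left_pos) auto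
  \<comment> \<open>Since \<open>1 \<le> X\<close>, replacing \<open>X\<close> by its square makes
    the right side a perfect square; this rounding produces the constant 400 and the full exponent
    \<open>(2 - q) / p\<close> of \<theta>.\<close>
  also have "\<dots> \<le> 160000 * (X * X) * r\<^sup>2"
    using X by (intro mult_right_mono) auto
  also have "\<dots> = (400 * X * r)\<^sup>2"
    by (simp add: power2_eq_square)
  finally have "d \<le> 400 * X * r"
    using X assms by (intro power2_le_imp_le[of d]) auto
  then show ?thesis
    by (simp add: X_def mult.assoc)
qed

theorem lemma3p8:
  fixes p q \<alpha> L1 L2 a\<^sub>\<alpha> :: real
  assumes "CARD('n::finite) \<ge> 2"
    and "0 < \<alpha>" "\<alpha> \<le> 1"
    and "2 < p" "p < q" "q < p + 2 * \<alpha> / (real CARD('n) + 2)"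
    and "0 < L1" "L1 \<le> L2"
    and "0 \<le> a\<^sub>\<alpha>"
  shows "\<exists>c \<ge> 1. \<forall>(\<Omega> :: (real^'n) set) (T :: real) (a :: 'n spacetime \<Rightarrow> real)
      (A :: 'n spacetime \<Rightarrow> real^'n^'m::finite \<Rightarrow> real^'n^'m) (F :: 'n spacetime \<Rightarrow> real^'n^'m)
      (u :: 'n spacetime \<Rightarrow> real^'m) (Du :: 'n spacetime \<Rightarrow> real^'n^'m) (\<delta> :: real)
      (z0 :: 'n spacetime) (\<rho> :: real) (\<pi> :: real) (\<rho>1 :: real) (\<rho>2 :: real)
      (\<theta> :: real) (\<Lambda> :: real) (\<zeta> :: nat \<Rightarrow> 'n spacetime).
    open \<Omega> \<and> connected \<Omega> \<and> \<Omega> \<noteq> {} \<and> bounded \<Omega> \<and> 0 < T \<and>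
    admissible_coefficient \<alpha> a\<^sub>\<alpha> (\<Omega> \<times> {0<..<T}) a \<and>
    caratheodory (\<Omega> \<times> {0<..<T}) A \<and>
    double_phase_growth p q L1 L2 (\<Omega> \<times> {0<..<T}) a A \<and>
    F \<in> borel_measurable (lebesgue_on (\<Omega> \<times> {0<..<T})) \<and>
    set_integrable lebesgue (\<Omega> \<times> {0<..<T}) (\<lambda>z. H a p q z (norm (F z))) \<and>
    0 < \<delta> \<and> \<delta> < 1 \<and> (q - 1) / p < \<delta> \<and> 2 - q * (1 - \<delta>) > 0 \<and>
    very_weak_solution p q \<delta> \<Omega> T a A F u Du \<and>
    z0 \<in> \<Omega> \<times> {0<..<T} \<and> 0 < \<rho> \<and> 1 < \<pi> \<and>
    (p_intrinsic p q \<alpha> \<delta> (\<Omega> \<times> {0<..<T}) a F Du z0 \<rho> \<pi> \<or>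
     pq_intrinsic p q \<delta> (\<Omega> \<times> {0<..<T}) a F Du z0 \<rho> \<pi>) \<and>
    \<rho> \<le> \<rho>1 \<and> \<rho>1 < \<rho>2 \<and> \<rho>2 \<le> 4 * \<rho> \<and>
    0 < \<theta> \<and> \<theta> < 1 \<and> \<theta> * H a p q z0 \<pi> \<le> \<Lambda>
    \<longrightarrow>
    (let Q2 = intr_cyl a p q \<pi> \<rho>2 z0;
         \<sigma>1 = half_time a p q \<pi> \<rho>1 z0;
         \<sigma>2 = half_time a p q \<pi> \<rho>2 z0;
         ae = extend_coeff \<alpha> a\<^sub>\<alpha> Q2 a;
         E = good_set p q ae (g_fun u Du F \<rho> Q2) \<Lambda>;
         U50 = (\<lambda>i. whitney_cyl ae p q \<Lambda> E 50 (\<zeta> i));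
         C1 = strip (snd z0) ((4 * \<sigma>1 + \<sigma>2) / 5);
         C2 = strip (snd z0) ((3 * \<sigma>1 + 2 * \<sigma>2) / 5)
     in - E \<noteq> {} \<and> (\<forall>z \<in> - E. 1 < lam ae p q \<Lambda> z) \<and>
        whitney_covering ae p q \<alpha> a\<^sub>\<alpha> \<Lambda> E \<zeta> \<longrightarrow>
        (\<forall>i \<in> Theta2 U50 C1 C2. U50 i \<inter> Q2 \<noteq> {} \<longrightarrow>
           \<rho>2 - \<rho>1 \<le> c * \<theta> powr ((2 - q) / p) * whitney_radius ae p q \<Lambda> E (\<zeta> i)))"
\<comment> \<open>The witness is the constant of the radius estimate with
  \<open>K = 2 + 4 * a\<^sub>\<alpha>\<close>; it depends only on \<open>p\<close>, \<open>q\<close>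
  and \<open>a\<^sub>\<alpha>\<close>.\<close>
proof (intro exI[of _ "400 * (1 + (2 + 4 * a\<^sub>\<alpha>)) powr ((q - 2) / p)"] conjI allI impI, goal_cases)
  case 1
  have "1 \<le> (1 + (2 + 4 * a\<^sub>\<alpha>)) powr ((q - 2) / p)"
    using assms by (intro ge_one_powr_ge_zero) auto
  then show ?case
    by simp
next
  case (2 \<Omega> T a A F u Du \<delta> z0 \<rho> \<pi> \<rho>1 \<rho>2 \<theta> \<Lambda> \<zeta>)
  define S where "S = \<Omega> \<times> {0<..<T}"
  define Q2 where "Q2 = intr_cyl a p q \<pi> \<rho>2 z0"
  define ae where "ae = extend_coeff \<alpha> a\<^sub>\<alpha> Q2 a"
  define E where "E = good_set p q ae (g_fun u Du F \<rho> Q2) \<Lambda>"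
  define r where "r = (\<lambda>i. whitney_radius ae p q \<Lambda> E (\<zeta> i))"
  define \<sigma> where "\<sigma> = (\<lambda>R. half_time a p q \<pi> R z0)"
  note hyp = 2[folded S_def]
  have adm: "admissible_coefficient \<alpha> a\<^sub>\<alpha> S a" and z0: "z0 \<in> S"
    and intr: "p_intrinsic p q \<alpha> \<delta> S a F Du z0 \<rho> \<pi> \<or> pq_intrinsic p q \<delta> S a F Du z0 \<rho> \<pi>"
    and pos: "0 < \<rho>" "1 < \<pi>" "\<rho> \<le> \<rho>1" "\<rho>1 < \<rho>2" "\<rho>2 \<le> 4 * \<rho>" "0 < \<theta>" "\<theta> < 1"
    and \<Lambda>: "\<theta> * H a p q z0 \<pi> \<le> \<Lambda>"
    using hyp by auto
  have a0: "0 \<le> a z0"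
    using adm z0 by (auto simp: admissible_coefficient_def)
  define P where "P = H a p q z0 \<pi>"
  have P: "0 < P"
    using a0 pos by (auto simp: P_def H_def add_pos_nonneg)
  have L: "0 < \<Lambda>"
    using \<Lambda>[folded P_def] P pos mult_pos_pos[of \<theta> P] by linarith
  have "\<rho>2 - \<rho>1 \<le> 400 * (1 + (2 + 4 * a\<^sub>\<alpha>)) powr ((q - 2) / p) * \<theta> powr ((2 - q) / p) * r i"
    if i: "i \<in> Theta2 (\<lambda>i. whitney_cyl ae p q \<Lambda> E 50 (\<zeta> i))
      (strip (snd z0) ((4 * \<sigma> \<rho>1 + \<sigma> \<rho>2) / 5)) (strip (snd z0) ((3 * \<sigma> \<rho>1 + 2 * \<sigma> \<rho>2) / 5))" for i
  proof -
    define \<mu> where "\<mu> = lam ae p q \<Lambda> (\<zeta> i)"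
    have "0 < \<rho>2"
      using pos by linarith
    note ext = extend_coeff_intrinsic[OF adm intr assms(2-4) assms(9) z0 pos(1,2,5) this,
      where z = "\<zeta> i", folded Q2_def ae_def P_def]
    have \<mu>: "0 < \<mu>" "H ae p q (\<zeta> i) \<mu> = \<Lambda>"
      unfolding \<mu>_def using assms L ext by (auto intro!: lam_eq)
    define \<kappa> where "\<kappa> = half_time ae p q \<mu> 1 (\<zeta> i)"
    have "0 < 50 * r i" and
      len: "(3 * \<sigma> \<rho>1 + 2 * \<sigma> \<rho>2) / 5 - (4 * \<sigma> \<rho>1 + \<sigma> \<rho>2) / 5 < 2 * (\<kappa> * (50 * r i)\<^sup>2)"
      using Theta2_half_time[OF i[unfolded whitney_cyl_def intr_cyl_eq]]
      by (simp_all add: half_time_factor[of _ _ _ _ "50 * _"] r_def \<kappa>_def \<mu>_def)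
    then have r: "0 < r i"
      by simp
    have "(\<rho>2 - \<rho>1)\<^sup>2 \<le> \<rho>2\<^sup>2 - \<rho>1\<^sup>2"
      using pos mult_left_mono[of \<rho>1 \<rho>2 \<rho>1] by (simp add: power2_eq_square algebra_simps)
    then have "\<pi>\<^sup>2 / P * (\<rho>2 - \<rho>1)\<^sup>2 \<le> half_time a p q \<pi> 1 z0 * (\<rho>2\<^sup>2 - \<rho>1\<^sup>2)"
      using half_time_bounds(1)[of a z0 \<pi> p q] a0 pos P
      by (intro mult_mono) (auto simp: P_def intro: order_trans[OF _ half_time_bounds(1)])
    also have "\<dots> = \<sigma> \<rho>2 - \<sigma> \<rho>1"
      unfolding \<sigma>_def by (subst (2 3) half_time_factor) (simp add: algebra_simps)
    \<comment> \<open>The strips differ by \<open>(\<sigma> \<rho>2 - \<sigma> \<rho>1) / 5\<close>,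
      and \<open>25000 = 5 * 2 * 50^2\<close>; the next step doubles it to 50000 when
      \<open>\<kappa>\<close> is compared with \<open>\<mu>\<^sup>2 / \<Lambda>\<close>.\<close>
    also have "\<dots> \<le> \<kappa> * (25000 * (r i)\<^sup>2)"
      using len by (simp add: power_mult_distrib field_simps)
    also have "\<dots> \<le> 2 * (\<mu>\<^sup>2 / \<Lambda>) * (25000 * (r i)\<^sup>2)"
      using half_time_bounds(2)[of ae "\<zeta> i" \<mu> p q] \<mu> ext
      by (intro mult_right_mono) (auto simp: \<kappa>_def)
    finally have "\<pi>\<^sup>2 / P * (\<rho>2 - \<rho>1)\<^sup>2 \<le> 50000 * (r i)\<^sup>2 * (\<mu>\<^sup>2 / \<Lambda>)"
      by (simp add: mult_ac)
    then show ?thesis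
      using assms pos r P ext \<mu> \<Lambda>
      by (intro intrinsic_radius_gap[where P = P and \<pi> = \<pi> and \<mu> = \<mu> and \<Lambda> = \<Lambda> and b = "ae (\<zeta> i)"])
        (auto simp: P_def H_def)
  qed
  then show ?case
    unfolding Let_def Q2_def[symmetric] ae_def[symmetric] E_def[symmetric] \<sigma>_def r_def by blast
qed

end
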